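(* $\theta_f(\overline{M_{22}})\le 22/6$.
   Context: The Mesner graph $M_{22}$ has as vertices the $77$ blocks of the Steiner system $S(3,6,22)$ (the unique family of $6$-subsets of $\{1,\dots,22\}$ such that every $3$-subset lies in exactly one block), two blocks being adjacent iff they are disjoint; $\overline{M_{22}}$ is its complement. $\theta_f(G)$, the fractional clique covering number, is the fractional chromatic number $\chi_f(\overline{G})=\inf_b\chi_b(\overline{G})/b$ of the complement, where $\chi_b$ is the least number of colours in an assignment of $b$-element colour sets to vertices with adjacent vertices receiving disjoint sets. *)

theory Defs
  imports Complex_Main "Graph_Theory.Pair_Digraph"
begin

definition steiner_system :: "nat \<Rightarrow> nat \<Rightarrow> 'a set \<Rightarrow> 'a set set \<Rightarrow> bool" where
  "steiner_system t k P B \<longleftrightarrow>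
     finite P \<and>
     (\<forall>X\<in>B. X \<subseteq> P \<and> card X = k) \<and>
     (\<forall>T. T \<subseteq> P \<and> card T = t \<longrightarrow> (\<exists>!X. X \<in> B \<and> T \<subseteq> X))"

text \<open>Simple graphs are represented as in the locale \<^locale>\<open>pair_graph\<close>: an edge is a pair of
  opposite arcs.\<close>

definition disjointness_graph :: "'a set set \<Rightarrow> 'a set pair_pre_digraph" where
  "disjointness_graph B =
     \<lparr> pverts = B, parcs = {(X, Y). X \<in> B \<and> Y \<in> B \<and> X \<inter> Y = {}} \<rparr>"

definition graph_complement :: "'a pair_pre_digraph \<Rightarrow> 'a pair_pre_digraph" where
  "graph_complement G =
     \<lparr> pverts = pverts G,
       parcs = {(u, v). u \<in> pverts G \<and> v \<in> pverts G \<and> u \<noteq> v \<and> (u, v) \<notin> parcs G} \<rparr>"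

text \<open>The colours are the natural numbers below \<open>n\<close>.\<close>

definition b_fold_colouring ::
    "'a pair_pre_digraph \<Rightarrow> nat \<Rightarrow> nat \<Rightarrow> ('a \<Rightarrow> nat set) \<Rightarrow> bool" where
  "b_fold_colouring G b n c \<longleftrightarrow>
     (\<forall>v\<in>pverts G. c v \<subseteq> {..<n} \<and> card (c v) = b) \<and>
     (\<forall>(u, v)\<in>parcs G. c u \<inter> c v = {})"

definition b_fold_chromatic_number :: "nat \<Rightarrow> 'a pair_pre_digraph \<Rightarrow> nat" where
  "b_fold_chromatic_number b G = (LEAST n. \<exists>c. b_fold_colouring G b n c)"

definition fractional_chromatic_number :: "'a pair_pre_digraph \<Rightarrow> real" where
  "fractional_chromatic_number G =
     (INF b\<in>{1..}. real (b_fold_chromatic_number b G) / real b)"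

definition fractional_clique_covering_number :: "'a pair_pre_digraph \<Rightarrow> real" where
  "fractional_clique_covering_number G = fractional_chromatic_number (graph_complement G)"

text \<open>On a Steiner system with nonempty blocks the disjointness graph has no loops and is indeed a
  finite simple graph; the same holds for complements.\<close>

lemma pair_graph_disjointness_graph:
  assumes "steiner_system t k P B" and "0 < k"
  shows "pair_graph (disjointness_graph B)"
proof -
  have "B \<subseteq> Pow P" and "finite P" using assms by (auto simp: steiner_system_def)
  then have fin: "finite B" by (meson finite_Pow_iff finite_subset)
  then have "finite (parcs (disjointness_graph B))"
    by (auto simp: disjointness_graph_def intro: finite_subset[of _ "B \<times> B"])
  with fin assms show ?thesis
    by unfold_locales
      (auto simp: disjointness_graph_def steiner_system_def symmetric_def intro!: symI)
qed

lemma pair_graph_graph_complement: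
  assumes "pair_graph G"
  shows "pair_graph (graph_complement G)"
proof -
  interpret pair_graph G by fact
  have "sym (parcs G)" using sym_arcs by (simp add: symmetric_def)
  moreover have "finite (parcs (graph_complement G))"
    by (auto simp: graph_complement_def intro: finite_subset[of _ "pverts G \<times> pverts G"])
  ultimately show ?thesis
    by unfold_locales
      (auto simp: graph_complement_def symmetric_def intro!: symI dest: symD)
qed

end

theory Submission
  imports Defs
begin

text \<open>The fractional clique covering number of the complement is the fractional chromatic
  number of the double complement, so it suffices to colour the disjointness graph itself. Adjacent
  blocks are disjoint, so giving each block its own 6 points as colours is a 6-fold colouring with
  22 colours (\<open>b_fold_colouring_disjointness_graph\<close>), and any such colouring bounds the
  infimum by 22/6.\<close>

lemma fractional_chromatic_number_le:
  assumes "b_fold_colouring G b n c" and "0 < b"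
  shows "fractional_chromatic_number G \<le> real n / real b"
proof -
  have "b_fold_chromatic_number b G \<le> n"
    unfolding b_fold_chromatic_number_def using assms(1) by (auto intro: Least_le)
  then have "real (b_fold_chromatic_number b G) / real b \<le> real n / real b"
    by (simp add: divide_right_mono)
  \<comment> \<open>A real infimum lies below each member only if the family is bounded below; the
    ratios are nonnegative, so 0 serves.\<close>
  moreover have "fractional_chromatic_number G \<le> real (b_fold_chromatic_number b G) / real b"
    unfolding fractional_chromatic_number_def
    using assms(2) by (intro cINF_lower bdd_belowI2[where m = 0]) auto
  ultimately show ?thesis by linarith
qed

text \<open>Fewer arcs mean fewer disjointness constraints, so this direction carries colourings of
  \<open>G\<close> over to its double complement. It holds for every \<open>G\<close>, whereas a
  loop would break equality.\<close>

lemma parcs_graph_complement_complement: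
  "parcs (graph_complement (graph_complement G)) \<subseteq> parcs G"
  by (auto simp: graph_complement_def)

text \<open>Each block serves as its own colour set, shifted by one because colours start at 0.\<close>

lemma b_fold_colouring_disjointness_graph:
  assumes "\<And>X. X \<in> B \<Longrightarrow> X \<subseteq> {1..n} \<and> card X = k"
  shows "b_fold_colouring (disjointness_graph B) k n (\<lambda>X. (\<lambda>x. x - 1) ` X)"
proof -
  \<comment> \<open>Truncated subtraction identifies 0 and 1, hence the restriction to points from 1
    on.\<close>
  have inj: "inj_on (\<lambda>x::nat. x - 1) {1..n}"
    by (auto simp: inj_on_def)
  have "(\<lambda>x. x - 1) ` X \<subseteq> {..<n} \<and> card ((\<lambda>x. x - 1) ` X) = k" if "X \<in> B" for X
    using assms[OF that] card_image[OF inj_on_subset[OF inj]] by fastforce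
  \<comment> \<open>An injective image commutes with intersection, so disjoint blocks keep disjoint
    colour sets.\<close>
  moreover have "(\<lambda>x. x - 1) ` X \<inter> (\<lambda>x. x - 1) ` Y = {}"
    if "X \<in> B" "Y \<in> B" "X \<inter> Y = {}" for X Y
    using that assms inj_on_image_Int[OF inj, of X Y] by auto
  ultimately show ?thesis
    by (auto simp: b_fold_colouring_def disjointness_graph_def)
qed

theorem theorem3p15:
  fixes B :: "nat set set"
  assumes "steiner_system 3 6 {1..22} B"
  shows "fractional_clique_covering_number (graph_complement (disjointness_graph B)) \<le> 22 / 6"
proof -
  let ?G = "disjointness_graph B"
  obtain c where "b_fold_colouring ?G 6 22 c"
    using b_fold_colouring_disjointness_graph[of B 22 6] assms
    by (auto simp: steiner_system_def)
  moreover have "pverts (graph_complement (graph_complement ?G)) = pverts ?G"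
    by (simp add: graph_complement_def)
  ultimately have "b_fold_colouring (graph_complement (graph_complement ?G)) 6 22 c"
    using parcs_graph_complement_complement[of ?G] by (simp add: b_fold_colouring_def) blast
  from fractional_chromatic_number_le[OF this] show ?thesis
    by (simp add: fractional_clique_covering_number_def)
qed

end
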